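(* Let $n\ge1$, $s\in\{0,1,\ldots,n-1\}$, and $f\in C^2(\mathbb{R}^n,\mathbb{R})$. Assume that the restriction $f_{|\mathbb{R}^{n,s}}$ is proper, i.e. $f^{-1}(K)\cap\mathbb{R}^{n,s}$ is compact for any compact set $K\subset\mathbb{R}$. Let $a<b$ be real numbers such that $M^b_a$ contains no M-stationary points for SCNO. Then $M^a$ is homeomorphic to $M^b$.
   Context: For $x\in\mathbb{R}^n$, $\|x\|_0$ is the number of non-zero entries of $x$, and $\mathbb{R}^{n,s}=\{x\in\mathbb{R}^n : \|x\|_0\le s\}$. SCNO is the problem $\min f(x)$ s.t. $x\in\mathbb{R}^{n,s}$. A point $\bar x\in\mathbb{R}^{n,s}$ is M-stationary for SCNO if $\frac{\partial f}{\partial x_i}(\bar x)=0$ for all $i$ with $\bar x_i\ne0$. For $a<b$ the lower level sets and intermediate sets are $M^a=\{x\in\mathbb{R}^{n,s}: f(x)\le a\}$ and $M^b_a=\{x\in\mathbb{R}^{n,s}: a\le f(x)\le b\}$. *)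

theory Defs
  imports "HOL-Analysis.Analysis"
begin

text \<open>Twice continuously differentiable on the whole space, in the Frechet sense, with the first and
  second derivative taken in the normed spaces of bounded linear maps.\<close>

definition C2 :: "('a::real_normed_vector \<Rightarrow> 'b::real_normed_vector) \<Rightarrow> bool" where
  "C2 f \<longleftrightarrow> (\<exists>(f' :: 'a \<Rightarrow> 'a \<Rightarrow>\<^sub>L 'b) (f'' :: 'a \<Rightarrow> 'a \<Rightarrow>\<^sub>L 'a \<Rightarrow>\<^sub>L 'b).
     (\<forall>x. (f has_derivative blinfun_apply (f' x)) (at x)) \<and>
     (\<forall>x. (f' has_derivative blinfun_apply (f'' x)) (at x)) \<and>
     continuous_on UNIV f'')"

definition partial_deriv :: "(real ^ 'n \<Rightarrow> real) \<Rightarrow> 'n::finite \<Rightarrow> real ^ 'n \<Rightarrow> real" where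
  "partial_deriv f i x = deriv (\<lambda>t. f (x + t *\<^sub>R axis i 1)) 0"

definition norm0 :: "real ^ 'n::finite \<Rightarrow> nat" where
  "norm0 x = card {i. x $ i \<noteq> 0}"

definition sparse_vecs :: "nat \<Rightarrow> (real ^ 'n::finite) set" where
  "sparse_vecs s = {x. norm0 x \<le> s}"

definition M_stationary :: "(real ^ 'n::finite \<Rightarrow> real) \<Rightarrow> nat \<Rightarrow> real ^ 'n \<Rightarrow> bool" where
  "M_stationary f s x \<longleftrightarrow>
     x \<in> sparse_vecs s \<and> (\<forall>i. x $ i \<noteq> 0 \<longrightarrow> partial_deriv f i x = 0)"

definition lower_level :: "(real ^ 'n::finite \<Rightarrow> real) \<Rightarrow> nat \<Rightarrow> real \<Rightarrow> (real ^ 'n) set" where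
  "lower_level f s a = {x \<in> sparse_vecs s. f x \<le> a}"

definition intermediate_set ::
    "(real ^ 'n::finite \<Rightarrow> real) \<Rightarrow> nat \<Rightarrow> real \<Rightarrow> real \<Rightarrow> (real ^ 'n) set" where
  "intermediate_set f s a b = {x \<in> sparse_vecs s. a \<le> f x \<and> f x \<le> b}"

end

theory Submission
  imports Defs
begin

text \<open>Put \<open>D\<^sub>i = \<partial>f/\<partial>x\<^sub>i\<close>. The field with coordinates \<open>- x\<^sub>i\<^sup>2 D\<^sub>i\<close> is tangent to every coordinate subspace,
  and \<open>f\<close> decreases along it at rate \<open>g = \<Sum>\<^sub>i (x\<^sub>i D\<^sub>i)\<^sup>2\<close>, which vanishes on the sparse vectors exactly at
  the M-stationary points. By compactness \<open>g \<ge> m > 0\<close> on the intermediate set. Dividing by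
  \<open>max g m\<close> and multiplying by a cutoff yields a globally Lipschitz field that still preserves sparsity,
  along which \<open>f\<close> decreases at rate in \<open>[0, 1]\<close> everywhere and at rate \<open>1\<close> on the intermediate set.
  Hence its flow over a short time \<open>T\<close> carries the lower level set at \<open>c + T\<close> onto the one at \<open>c\<close>, for
  \<open>a \<le> c\<close> and \<open>c + T \<le> b\<close>. The time is kept so short that Picard's operator is a contraction in the
  plain supremum norm, and \<open>[a, b]\<close> is covered by finitely many such steps.\<close>

subsection \<open>Short-time flows of Lipschitz fields\<close>

text \<open>The derivative is taken within the closed interval, hence one-sided at its ends. This
  keeps the notion stable under time reversal and lets Picard's integral equation be used on
  \<open>{0..T}\<close> alone.\<close>

definition solution_on :: "real \<Rightarrow> ('a::real_normed_vector \<Rightarrow> 'a) \<Rightarrow> (real \<Rightarrow> 'a) \<Rightarrow> bool" where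
  "solution_on T X u \<longleftrightarrow> (\<forall>t\<in>{0..T}. (u has_vector_derivative X (u t)) (at t within {0..T}))"

lemma solution_onD:
  "solution_on T X u \<Longrightarrow> t \<in> {0..T} \<Longrightarrow> (u has_vector_derivative X (u t)) (at t within {0..T})"
  by (simp add: solution_on_def)

text \<open>A short-time substitute for Gronwall's inequality: at a maximum point of \<open>norm (w t)\<close> the mean
  value inequality gives \<open>norm (w t - w 0) \<le> norm (w t) / 2\<close>.\<close>

lemma norm_le_of_derivative_le:
  fixes w :: "real \<Rightarrow> 'a::real_normed_vector"
  assumes w: "\<And>t. t \<in> {0..T} \<Longrightarrow> (w has_vector_derivative w' t) (at t within {0..T})"
    and w': "\<And>t. t \<in> {0..T} \<Longrightarrow> norm (w' t) \<le> L * norm (w t)"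
    and "0 \<le> L" "T * L \<le> 1/2" "t \<in> {0..T}"
  shows "norm (w t) \<le> 2 * norm (w 0)"
proof -
  have "continuous_on {0..T} w"
    using w has_vector_derivative_continuous continuous_on_eq_continuous_within by blast
  then obtain m where m: "m \<in> {0..T}" "\<And>t. t \<in> {0..T} \<Longrightarrow> norm (w t) \<le> norm (w m)"
    using continuous_attains_sup[of "{0..T}" "\<lambda>t. norm (w t)"] assms(5) continuous_on_norm
    by (metis compact_Icc empty_iff)
  have "norm (w m - w 0) \<le> L * norm (w m) * norm (m - 0)"
  proof (rule differentiable_bound[of "{0..T}"])
    fix x assume x: "x \<in> {0..T}"
    show "(w has_derivative (\<lambda>h. h *\<^sub>R w' x)) (at x within {0..T})"
      using w[OF x] by (simp add: has_vector_derivative_def)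
    have "onorm (\<lambda>h. h *\<^sub>R w' x) \<le> norm (w' x)"
      by (rule onorm_le) (simp add: mult.commute)
    also have "\<dots> \<le> L * norm (w m)"
      using w'[OF x] mult_left_mono[OF m(2)[OF x] \<open>0 \<le> L\<close>] by linarith
    finally show "onorm (\<lambda>h. h *\<^sub>R w' x) \<le> L * norm (w m)" .
  qed (use m assms(5) in auto)
  also have "\<dots> = (m * L) * norm (w m)"
    using m(1) by simp
  also have "\<dots> \<le> (1/2) * norm (w m)"
  proof (intro mult_right_mono)
    have "m * L \<le> T * L"
      using m(1) \<open>0 \<le> L\<close> by (intro mult_right_mono) auto
    then show "m * L \<le> 1/2"
      using assms(4) by linarith
  qed simp
  finally have "norm (w m) \<le> 2 * norm (w 0)"
    using norm_triangle_ineq[of "w m - w 0" "w 0"] by simp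
  then show ?thesis
    using m(2)[OF assms(5)] by linarith
qed

text \<open>The difference of two solutions meets the short-time bound above. Equal initial values
  give uniqueness; in general the time-\<open>T\<close> map is Lipschitz with constant 2.\<close>

lemma solution_on_dist_le:
  assumes "L-lipschitz_on UNIV X" "T * L \<le> 1/2" "solution_on T X u" "solution_on T X v"
    and "t \<in> {0..T}"
  shows "dist (u t) (v t) \<le> 2 * dist (u 0) (v 0)"
  unfolding dist_norm
proof (rule norm_le_of_derivative_le)
  fix t assume t: "t \<in> {0..T}"
  show "((\<lambda>t. u t - v t) has_vector_derivative (X (u t) - X (v t))) (at t within {0..T})"
    using assms t by (intro derivative_intros solution_onD)
  show "norm (X (u t) - X (v t)) \<le> L * norm (u t - v t)"
    using assms(1) lipschitz_on_normD by blast
qed (use assms lipschitz_on_nonneg in auto)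

text \<open>Picard iteration: since \<open>T * L\<close> is at most 1/2, the integral operator
  halves distances, and Banach's theorem gives a fixed point, which solves the equation.\<close>

lemma solution_on_exists:
  fixes X :: "'a::banach \<Rightarrow> 'a"
  assumes X: "L-lipschitz_on UNIV X" and "0 \<le> T" "T * L \<le> 1/2"
  shows "\<exists>u. solution_on T X u \<and> u 0 = x"
proof -
  have cX: "continuous_on S (\<lambda>s. X (u s))" if "continuous_on S u" for u and S :: "real set"
    using continuous_on_compose2[OF lipschitz_on_continuous_on[OF X] that] by simp
  have clamp: "clamp 0 T t \<in> {0..T}" for t
    using clamp_in_interval[of 0 T t] \<open>0 \<le> T\<close> by simp
  \<comment> \<open>Clamping the upper limit makes the integral constant outside
    \<open>{0..T}\<close>, so Picard's operator maps the complete space of bounded continuous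
    functions on the line to itself.\<close>
  have "\<exists>v::real \<Rightarrow>\<^sub>C 'a. \<forall>t. v t = x + integral {0..clamp 0 T t} (\<lambda>s. X (u s))" for u :: "real \<Rightarrow>\<^sub>C 'a"
  proof -
    have "continuous_on (cbox 0 T) (\<lambda>t. x + integral {0..t} (\<lambda>s. X (u s)))"
      unfolding cbox_interval
      by (intro continuous_intros indefinite_integral_continuous_1 integrable_continuous_real cX) auto
    from continuous_on_cbox_bcontfunE[OF this] show ?thesis
      by metis
  qed
  then obtain P :: "(real \<Rightarrow>\<^sub>C 'a) \<Rightarrow> (real \<Rightarrow>\<^sub>C 'a)"
    where P: "\<And>u t. P u t = x + integral {0..clamp 0 T t} (\<lambda>s. X (u s))"
    by metis
  have contr: "dist (P u) (P v) \<le> 1/2 * dist u v" for u v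
  proof (rule dist_bound)
    fix t
    define c where "c = clamp 0 T t"
    have c: "c \<in> {0..T}"
      using clamp by (simp add: c_def)
    have "P u t - P v t = integral {0..c} (\<lambda>s. X (u s)) - integral {0..c} (\<lambda>s. X (v s))"
      by (simp add: P c_def)
    also have "\<dots> = integral {0..c} (\<lambda>s. X (u s) - X (v s))"
      by (intro integral_diff[symmetric] integrable_continuous_real cX) auto
    finally have "dist (P u t) (P v t) = norm (integral {0..c} (\<lambda>s. X (u s) - X (v s)))"
      by (simp add: dist_norm)
    also have "\<dots> \<le> (L * dist u v) * (c - 0)"
    proof (rule integral_bound)
      show "continuous_on {0..c} (\<lambda>s. X (u s) - X (v s))"
        by (intro continuous_intros cX) auto
      fix s
      have "norm (X (u s) - X (v s)) \<le> L * dist (u s) (v s)"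
        using lipschitz_onD[OF X] by (simp add: dist_norm)
      also have "\<dots> \<le> L * dist u v"
        using lipschitz_on_nonneg[OF X] by (intro mult_left_mono dist_bounded)
      finally show "norm (X (u s) - X (v s)) \<le> L * dist u v" .
    qed (use c in auto)
    also have "\<dots> = (c * L) * dist u v"
      by simp
    also have "\<dots> \<le> 1/2 * dist u v"
    proof (intro mult_right_mono)
      have "c * L \<le> T * L"
        using c lipschitz_on_nonneg[OF X] by (intro mult_right_mono) auto
      then show "c * L \<le> 1/2"
        using assms(3) by linarith
    qed simp
    finally show "dist (P u t) (P v t) \<le> 1/2 * dist u v" .
  qed
  then obtain u where u: "P u = u"
    using banach_fix_type[of "1/2" P] by auto
  have u_eq: "u t = x + integral {0..t} (\<lambda>s. X (u s))" if "t \<in> {0..T}" for t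
    using P[of u t] that u by simp
  have "solution_on T X u"
    unfolding solution_on_def
  proof
    fix t assume t: "t \<in> {0..T}"
    have "((\<lambda>t. x + integral {0..t} (\<lambda>s. X (u s))) has_vector_derivative 0 + X (u t)) (at t within {0..T})"
      using t by (intro derivative_intros integral_has_vector_derivative cX) auto
    then show "(u has_vector_derivative X (u t)) (at t within {0..T})"
      using has_vector_derivative_transform[OF t u_eq] by simp
  qed
  moreover have "u 0 = x"
    using u_eq[of 0] \<open>0 \<le> T\<close> by simp
  ultimately show ?thesis
    by blast
qed

text \<open>Chain rule with inner derivative -1. Together with uniqueness this makes the flow of
  \<open>- X\<close> the inverse of the flow of \<open>X\<close>.\<close>

lemma solution_on_reverse:
  assumes "solution_on T X u"
  shows "solution_on T (\<lambda>x. - X x) (\<lambda>t. u (T - t))"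
  unfolding solution_on_def
proof
  fix t assume t: "t \<in> {0..T}"
  have im: "(\<lambda>t. T - t) ` {0..T} = {0..T}"
    by (auto simp: image_iff intro: bexI[of _ "T - x" for x])
  have "((u \<circ> (\<lambda>t. T - t)) has_vector_derivative (-1) *\<^sub>R X (u (T - t))) (at t within {0..T})"
  proof (rule vector_diff_chain_within)
    show "((\<lambda>t. T - t) has_vector_derivative - 1) (at t within {0..T})"
      by (auto intro!: derivative_eq_intros)
    show "(u has_vector_derivative X (u (T - t))) (at (T - t) within (\<lambda>t. T - t) ` {0..T})"
      unfolding im using t by (intro solution_onD[OF assms]) auto
  qed
  then show "((\<lambda>t. u (T - t)) has_vector_derivative - X (u (T - t))) (at t within {0..T})"
    by (simp add: o_def)
qed

text \<open>The time-\<open>T\<close> maps of \<open>X\<close> and \<open>- X\<close> are continuous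
  and mutually inverse. The assumptions \<open>fwd\<close> and \<open>bwd\<close> speak of arbitrary
  solutions, so that applying the lemma requires no named flow.\<close>

lemma homeomorphic_by_flow:
  fixes X :: "'a::banach \<Rightarrow> 'a"
  assumes X: "L-lipschitz_on UNIV X" and T: "0 \<le> T" "T * L \<le> 1/2"
    and fwd: "\<And>u. solution_on T X u \<Longrightarrow> u 0 \<in> S \<Longrightarrow> u T \<in> S'"
    and bwd: "\<And>u. solution_on T (\<lambda>x. - X x) u \<Longrightarrow> u 0 \<in> S' \<Longrightarrow> u T \<in> S"
  shows "S homeomorphic S'"
proof -
  have flow: "\<exists>\<phi>. (\<forall>x. solution_on T Y (\<phi> x) \<and> \<phi> x 0 = x) \<and> continuous_on UNIV (\<lambda>x. \<phi> x T)"
    if Y: "L-lipschitz_on UNIV Y" for Y :: "'a \<Rightarrow> 'a"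
  proof -
    obtain \<phi> where \<phi>: "\<And>x. solution_on T Y (\<phi> x)" "\<And>x. \<phi> x 0 = x"
      using solution_on_exists[OF Y T] by metis
    have "2-lipschitz_on UNIV (\<lambda>x. \<phi> x T)"
      using solution_on_dist_le[OF Y T(2) \<phi>(1) \<phi>(1), of T] T(1) by (intro lipschitz_onI) (auto simp: \<phi>(2))
    then show ?thesis
      using \<phi> lipschitz_on_continuous_on by blast
  qed
  have nX: "L-lipschitz_on UNIV (\<lambda>x. - X x)"
    using X by simp
  obtain \<phi> where \<phi>: "\<And>x. solution_on T X (\<phi> x)" "\<And>x. \<phi> x 0 = x" "continuous_on UNIV (\<lambda>x. \<phi> x T)"
    using flow[OF X] by blast
  obtain \<psi> where \<psi>: "\<And>x. solution_on T (\<lambda>x. - X x) (\<psi> x)" "\<And>x. \<psi> x 0 = x"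
      "continuous_on UNIV (\<lambda>x. \<psi> x T)"
    using flow[OF nX] by blast
  \<comment> \<open>The reversed trajectory of \<open>x\<close> and the backward solution both start
    at \<open>\<phi> x T\<close>, so they agree at time \<open>T\<close>.\<close>
  have \<psi>\<phi>: "\<psi> (\<phi> x T) T = x" for x
    using solution_on_dist_le[OF nX T(2) \<psi>(1) solution_on_reverse[OF \<phi>(1)], of T "\<phi> x T" x] T(1)
    by (simp add: \<phi>(2) \<psi>(2))
  have "solution_on T X (\<lambda>t. \<psi> x (T - t))" for x
    using solution_on_reverse[OF \<psi>(1)] by simp
  then have \<phi>\<psi>: "\<phi> (\<psi> x T) T = x" for x
    using solution_on_dist_le[OF X T(2) \<phi>(1), of "\<lambda>t. \<psi> x (T - t)" T "\<psi> x T"] T(1)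
    by (simp add: \<phi>(2) \<psi>(2))
  have "\<phi> x T \<in> S'" if "x \<in> S" for x
    using fwd[OF \<phi>(1)] that by (simp add: \<phi>(2))
  moreover have "\<psi> x T \<in> S" if "x \<in> S'" for x
    using bwd[OF \<psi>(1)] that by (simp add: \<psi>(2))
  ultimately have "homeomorphism S S' (\<lambda>x. \<phi> x T) (\<lambda>x. \<psi> x T)"
    using \<phi>\<psi> \<psi>\<phi> \<phi>(3) \<psi>(3) by (intro homeomorphismI) (auto intro: continuous_on_subset)
  then show ?thesis
    using homeomorphic_def by blast
qed

subsection \<open>Lipschitz functions on bounded sets\<close>

lemma lipschitz_on_bounded_image:
  assumes "L-lipschitz_on S g" "bounded S"
  shows "bounded (g ` S)"
proof (cases "S = {}")
  case False
  then obtain z where z: "z \<in> S" by blast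
  obtain e where e: "\<And>x. x \<in> S \<Longrightarrow> dist z x \<le> e"
    using \<open>bounded S\<close> by (auto simp: bounded_any_center[of _ z])
  have "dist (g z) (g x) \<le> L * e" if "x \<in> S" for x
    using lipschitz_onD[OF assms(1) z that] e[OF that] lipschitz_on_nonneg[OF assms(1)]
    by (meson mult_left_mono order_trans)
  then show ?thesis
    unfolding bounded_def by blast
qed simp

text \<open>Lipschitz functions on a bounded set are bounded, so the product rule for differences
  applies. The constants are existentially quantified so that such closure rules compose without
  tracking them.\<close>

lemma lipschitz_on_mult:
  fixes g h :: "'a::metric_space \<Rightarrow> real"
  assumes "bounded S" "\<exists>C. C-lipschitz_on S g" "\<exists>C. C-lipschitz_on S h"
  shows "\<exists>C. C-lipschitz_on S (\<lambda>x. g x * h x)"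
proof -
  obtain C D where C: "C-lipschitz_on S g" and D: "D-lipschitz_on S h"
    using assms by blast
  obtain A B where A: "0 < A" "\<And>x. x \<in> S \<Longrightarrow> \<bar>g x\<bar> \<le> A" and B: "0 < B" "\<And>x. x \<in> S \<Longrightarrow> \<bar>h x\<bar> \<le> B"
    using lipschitz_on_bounded_image[OF C assms(1)] lipschitz_on_bounded_image[OF D assms(1)]
    by (fastforce simp: bounded_pos)
  have "(A * D + B * C)-lipschitz_on S (\<lambda>x. g x * h x)"
  proof (rule lipschitz_onI)
    fix x y assume xy: "x \<in> S" "y \<in> S"
    have "g x * h x - g y * h y = g x * (h x - h y) + h y * (g x - g y)"
      by algebra
    then have "dist (g x * h x) (g y * h y) \<le> \<bar>g x\<bar> * dist (h x) (h y) + \<bar>h y\<bar> * dist (g x) (g y)"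
      by (metis abs_mult abs_triangle_ineq dist_real_def)
    also have "\<dots> \<le> A * (D * dist x y) + B * (C * dist x y)"
      using xy lipschitz_onD[OF C] lipschitz_onD[OF D] A B by (intro add_mono mult_mono) auto
    finally show "dist (g x * h x) (g y * h y) \<le> (A * D + B * C) * dist x y"
      by (simp add: algebra_simps)
  qed (use A B lipschitz_on_nonneg[OF C] lipschitz_on_nonneg[OF D] in auto)
  then show ?thesis ..
qed

lemma lipschitz_on_inverse:
  fixes h :: "'a::metric_space \<Rightarrow> real"
  assumes "\<exists>C. C-lipschitz_on S h" "0 < m" "\<And>x. x \<in> S \<Longrightarrow> m \<le> h x"
  shows "\<exists>C. C-lipschitz_on S (\<lambda>x. inverse (h x))"
proof -
  obtain C where C: "C-lipschitz_on S h"
    using assms by blast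
  have "(C / (m * m))-lipschitz_on S (\<lambda>x. inverse (h x))"
  proof (rule lipschitz_onI)
    fix x y assume xy: "x \<in> S" "y \<in> S"
    have pos: "0 < h x" "0 < h y"
      using assms(2) assms(3)[OF xy(1)] assms(3)[OF xy(2)] by linarith+
    then have "inverse (h x) - inverse (h y) = (h y - h x) / (h x * h y)"
      by (simp add: field_simps)
    then have "dist (inverse (h x)) (inverse (h y)) = dist (h x) (h y) / (h x * h y)"
      using pos by (simp add: dist_real_def abs_minus_commute)
    also have "\<dots> \<le> (C * dist x y) / (m * m)"
      using lipschitz_onD[OF C xy] assms(2) assms(3)[OF xy(1)] assms(3)[OF xy(2)]
      by (intro frac_le mult_mono order_trans[OF zero_le_dist lipschitz_onD[OF C xy]]) auto
    finally show "dist (inverse (h x)) (inverse (h y)) \<le> C / (m * m) * dist x y"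
      by simp
  qed (use lipschitz_on_nonneg[OF C] in simp)
  then show ?thesis ..
qed

lemma lipschitz_on_sum:
  fixes g :: "'i \<Rightarrow> 'a::metric_space \<Rightarrow> 'b::real_normed_vector"
  assumes "finite I" "\<And>i. i \<in> I \<Longrightarrow> \<exists>C. C-lipschitz_on S (g i)"
  shows "\<exists>C. C-lipschitz_on S (\<lambda>x. \<Sum>i\<in>I. g i x)"
  using assms
proof (induction rule: finite_induct)
  case empty
  show ?case
    using lipschitz_on_constant by force
next
  case (insert i I)
  then obtain C D where "C-lipschitz_on S (g i)" "D-lipschitz_on S (\<lambda>x. \<Sum>i\<in>I. g i x)"
    by (meson insertCI)
  then show ?case
    using insert lipschitz_on_add by fastforce
qed

lemma lipschitz_on_max:
  fixes g :: "'a::metric_space \<Rightarrow> real"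
  assumes "\<exists>C. C-lipschitz_on S g"
  shows "\<exists>C. C-lipschitz_on S (\<lambda>x. max (g x) m)"
proof -
  obtain C where C: "C-lipschitz_on S g"
    using assms by blast
  have "C-lipschitz_on S (\<lambda>x. max (g x) m)"
  proof (rule lipschitz_onI)
    fix x y assume xy: "x \<in> S" "y \<in> S"
    have "dist (max (g x) m) (max (g y) m) \<le> dist (g x) (g y)"
      by (auto simp: dist_real_def max_def)
    then show "dist (max (g x) m) (max (g y) m) \<le> C * dist x y"
      using lipschitz_onD[OF C xy] by linarith
  qed (rule lipschitz_on_nonneg[OF C])
  then show ?thesis ..
qed

lemma lipschitz_on_cart:
  fixes X :: "'a::metric_space \<Rightarrow> real ^ 'n::finite"
  assumes "\<And>i. \<exists>C. C-lipschitz_on S (\<lambda>x. X x $ i)"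
  shows "\<exists>C. C-lipschitz_on S X"
proof -
  obtain C where C: "\<And>i. (C i)-lipschitz_on S (\<lambda>x. X x $ i)"
    using assms by metis
  have "(\<Sum>i\<in>UNIV. C i)-lipschitz_on S X"
  proof (rule lipschitz_onI)
    fix x y assume xy: "x \<in> S" "y \<in> S"
    have "dist (X x) (X y) \<le> (\<Sum>i\<in>UNIV. dist (X x $ i) (X y $ i))"
      unfolding dist_norm by (rule order_trans[OF norm_le_l1_cart]) simp
    also have "\<dots> \<le> (\<Sum>i\<in>UNIV. C i * dist x y)"
      using lipschitz_onD[OF C xy] by (intro sum_mono)
    finally show "dist (X x) (X y) \<le> (\<Sum>i\<in>UNIV. C i) * dist x y"
      by (simp add: sum_distrib_right)
  qed (use lipschitz_on_nonneg[OF C] in \<open>auto intro: sum_nonneg\<close>)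
  then show ?thesis ..
qed

text \<open>The ball is compact, which bounds the derivative, and convex, which lets the mean value
  inequality turn that bound into a Lipschitz constant.\<close>

lemma C1_lipschitz_on_cball:
  fixes F :: "'a::euclidean_space \<Rightarrow> 'b::real_normed_vector"
  assumes F: "\<And>x. (F has_derivative blinfun_apply (F' x)) (at x)" and F': "continuous_on UNIV F'"
  shows "\<exists>C. C-lipschitz_on (cball c r) F"
proof -
  have "bounded (F' ` cball c r)"
    using F' by (intro compact_imp_bounded compact_continuous_image) (auto intro: continuous_on_subset)
  then obtain C where C: "0 < C" "\<And>x. x \<in> cball c r \<Longrightarrow> norm (F' x) \<le> C"
    by (fastforce simp: bounded_pos)
  have "C-lipschitz_on (cball c r) F"
  proof (rule bounded_derivative_imp_lipschitz)
    show "(F has_derivative blinfun_apply (F' x)) (at x within cball c r)" for x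
      using F has_derivative_at_withinI by blast
    show "onorm (blinfun_apply (F' x)) \<le> C" if "x \<in> cball c r" for x
      using C(2)[OF that] by (simp add: norm_blinfun.rep_eq)
  qed (use C in auto)
  then show ?thesis ..
qed

section \<open>From Lipschitz on balls to globally Lipschitz by cutting off\<close>

text \<open>A piecewise linear profile suffices in place of a smooth bump, because the flow asks
  only for a Lipschitz field.\<close>

definition cutoff :: "real \<Rightarrow> 'a::real_normed_vector \<Rightarrow> real" where
  "cutoff r x = max 0 (min 1 (r + 1 - norm x))"

lemma cutoff_bounds: "0 \<le> cutoff r x" "cutoff r x \<le> 1"
  by (auto simp: cutoff_def)

lemma cutoff_eq_1: "norm x \<le> r \<Longrightarrow> cutoff r x = 1"
  by (simp add: cutoff_def)

lemma cutoff_eq_0: "x \<notin> cball 0 (r + 1) \<Longrightarrow> cutoff r x = 0"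
  by (simp add: cutoff_def)

lemma lipschitz_on_cutoff: "1-lipschitz_on S (cutoff r)"
proof (rule lipschitz_onI)
  fix x y :: 'a
  have "dist (cutoff r x) (cutoff r y) \<le> \<bar>norm x - norm y\<bar>"
    by (auto simp: cutoff_def dist_real_def max_def min_def)
  also have "\<dots> \<le> norm (x - y)"
    by (rule norm_triangle_ineq3)
  finally show "dist (cutoff r x) (cutoff r y) \<le> 1 * dist x y"
    by (simp add: dist_norm)
qed simp

lemma lipschitz_on_cutoff_mult:
  fixes g :: "'a::real_normed_vector \<Rightarrow> real"
  assumes "\<exists>C. C-lipschitz_on (cball 0 (r + 1)) g"
  shows "\<exists>C. C-lipschitz_on UNIV (\<lambda>x. cutoff r x * g x)"
proof -
  let ?B = "cball (0::'a) (r + 1)"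
  obtain G where G: "G-lipschitz_on ?B g"
    using assms by blast
  then obtain A where A: "0 < A" "\<And>x. x \<in> ?B \<Longrightarrow> \<bar>g x\<bar> \<le> A"
    using lipschitz_on_bounded_image[OF G bounded_cball] by (fastforce simp: bounded_pos)
  obtain C where C: "C-lipschitz_on ?B (\<lambda>x. cutoff r x * g x)"
    using lipschitz_on_mult[OF bounded_cball _ assms] lipschitz_on_cutoff by blast
  \<comment> \<open>As the cutoff vanishes at \<open>y\<close>, the difference equals that of the
    cutoffs times \<open>g x\<close>; thus only the bound \<open>A\<close> of \<open>g\<close>
    inside the ball enters, whatever \<open>g\<close> does outside.\<close>
  have mixed: "dist (cutoff r x * g x) (cutoff r y * g y) \<le> (A + C) * dist x y"
    if "x \<in> ?B" "y \<notin> ?B" for x y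
  proof -
    have "dist (cutoff r x * g x) (cutoff r y * g y) = dist (cutoff r x) (cutoff r y) * \<bar>g x\<bar>"
      using cutoff_eq_0[OF that(2)] by (simp add: dist_real_def abs_mult)
    also have "\<dots> \<le> dist x y * A"
      using lipschitz_onD[OF lipschitz_on_cutoff[of UNIV r]] A that by (intro mult_mono) auto
    also have "\<dots> \<le> (A + C) * dist x y"
      using lipschitz_on_nonneg[OF C] by (simp add: algebra_simps)
    finally show ?thesis .
  qed
  have "(A + C)-lipschitz_on UNIV (\<lambda>x. cutoff r x * g x)"
  proof (rule lipschitz_onI)
    fix x y :: 'a
    consider "x \<in> ?B" "y \<in> ?B" | "x \<in> ?B" "y \<notin> ?B" | "x \<notin> ?B" "y \<in> ?B" | "x \<notin> ?B" "y \<notin> ?B"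
      by blast
    then show "dist (cutoff r x * g x) (cutoff r y * g y) \<le> (A + C) * dist x y"
    proof cases
      case 1
      have "C * dist x y \<le> (A + C) * dist x y"
        using A by (intro mult_right_mono) auto
      then show ?thesis
        using lipschitz_onD[OF C 1] by linarith
    next
      case 3
      then show ?thesis
        using mixed[of y x] by (simp add: dist_commute)
    next
      case 4
      then show ?thesis
        using A lipschitz_on_nonneg[OF C] by (simp add: cutoff_eq_0)
    qed (rule mixed)
  qed (use A lipschitz_on_nonneg[OF C] in simp)
  then show ?thesis ..
qed

subsection \<open>A sparsity-preserving descent field\<close>

lemma norm_axis_real: "norm (axis i c :: real ^ 'n::finite) = \<bar>c\<bar>"
proof -
  have "axis i c = c *\<^sub>R (axis i 1 :: real ^ 'n)"
    by (simp add: vec_eq_iff axis_def)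
  then show ?thesis
    by simp
qed

lemma blinfun_apply_cart:
  fixes A :: "(real ^ 'n::finite) \<Rightarrow>\<^sub>L real"
  shows "blinfun_apply A v = (\<Sum>i\<in>UNIV. v $ i * blinfun_apply A (axis i 1))"
proof -
  have "blinfun_apply A v = blinfun_apply A (\<Sum>i\<in>UNIV. v $ i *\<^sub>R axis i 1)"
    using basis_expansion[of v] by (simp add: scalar_mult_eq_scaleR)
  then show ?thesis
    by (simp add: blinfun.sum_right blinfun.scaleR_right)
qed

text \<open>Chain rule along the coordinate line; it links stationarity, stated with
  \<open>deriv\<close>, to the Frechet derivative.\<close>

lemma partial_deriv_eq:
  assumes "(f has_derivative blinfun_apply A) (at x)"
  shows "partial_deriv f i x = blinfun_apply A (axis i 1)"
proof -
  have "((\<lambda>t::real. x + t *\<^sub>R axis i 1) has_vector_derivative axis i 1) (at 0)"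
    by (auto intro!: derivative_eq_intros)
  then have "((f \<circ> (\<lambda>t. x + t *\<^sub>R axis i 1)) has_vector_derivative blinfun_apply A (axis i 1)) (at 0)"
    by (rule vector_derivative_diff_chain_within) (simp add: assms has_derivative_at_withinI)
  then show ?thesis
    unfolding partial_deriv_def o_def
    by (intro DERIV_imp_deriv) (simp add: has_real_derivative_iff_has_vector_derivative)
qed

text \<open>The field is built on the whole space, and \<open>K\<close> will be the intermediate
  set. Vanishing wherever \<open>x $ i\<close> does is what later keeps trajectories sparse.\<close>

lemma descent_field_exists:
  fixes f :: "real ^ 'n::finite \<Rightarrow> real"
  assumes f: "\<And>x. (f has_derivative blinfun_apply (f' x)) (at x)"
    and f': "\<And>x. (f' has_derivative blinfun_apply (f'' x)) (at x)" "continuous_on UNIV f''"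
    and K: "compact K"
    and nonstat: "\<And>x. x \<in> K \<Longrightarrow> \<exists>i. x $ i \<noteq> 0 \<and> blinfun_apply (f' x) (axis i 1) \<noteq> 0"
  obtains L X where "L-lipschitz_on UNIV X" "\<And>x i. x $ i = 0 \<Longrightarrow> X x $ i = 0"
    "\<And>x. blinfun_apply (f' x) (X x) \<in> {-1..0}" "\<And>x. x \<in> K \<Longrightarrow> blinfun_apply (f' x) (X x) = -1"
proof -
  define D where "D i x = blinfun_apply (f' x) (axis i 1)" for i x
  define g where "g x = (\<Sum>i\<in>UNIV. (x $ i * D i x) * (x $ i * D i x))" for x
  have g0: "0 \<le> g x" for x
    by (simp add: g_def sum_nonneg)
  have gpos: "0 < g x" if "x \<in> K" for x
  proof -
    obtain i where "x $ i * D i x \<noteq> 0"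
      using nonstat[OF \<open>x \<in> K\<close>] by (auto simp: D_def)
    then have "0 < (x $ i * D i x) * (x $ i * D i x)"
      using not_real_square_gt_zero by blast
    also have "\<dots> \<le> g x"
      unfolding g_def by (rule member_le_sum) auto
    finally show ?thesis .
  qed
  \<comment> \<open>Here the second derivative enters: its continuity makes \<open>f'\<close>, and
    with it every \<open>D i\<close>, Lipschitz on balls.\<close>
  have lipf': "\<exists>C. C-lipschitz_on (cball 0 r) f'" for r
    by (rule C1_lipschitz_on_cball[OF f'])
  have lipD: "\<exists>C. C-lipschitz_on (cball 0 r) (D i)" for r i
  proof -
    obtain C where C: "C-lipschitz_on (cball 0 r) f'"
      using lipf' by blast
    have "C-lipschitz_on (cball 0 r) (D i)"
    proof (rule lipschitz_onI)
      fix x y :: "real ^ 'n" assume xy: "x \<in> cball 0 r" "y \<in> cball 0 r"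
      have "D i x - D i y = blinfun_apply (f' x - f' y) (axis i 1)"
        by (simp add: D_def blinfun.diff_left)
      then have "dist (D i x) (D i y) \<le> norm (f' x - f' y)"
        using norm_blinfun[of "f' x - f' y" "axis i 1"] by (simp add: dist_norm norm_axis_1)
      then show "dist (D i x) (D i y) \<le> C * dist x y"
        using lipschitz_onD[OF C xy] by (simp add: dist_norm)
    qed (rule lipschitz_on_nonneg[OF C])
    then show ?thesis ..
  qed
  have lipc: "\<exists>C. C-lipschitz_on S (\<lambda>x::real^'n. x $ i)" for S i
    by (rule exI[of _ 1]) (auto intro!: lipschitz_onI simp: dist_vec_nth_le)
  have lipxD: "\<exists>C. C-lipschitz_on (cball 0 r) (\<lambda>x. x $ i * D i x)" for r i
    by (intro lipschitz_on_mult bounded_cball lipc lipD)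
  have lipg: "\<exists>C. C-lipschitz_on (cball 0 r) g" for r
    unfolding g_def by (intro lipschitz_on_sum lipschitz_on_mult bounded_cball lipxD) simp
  obtain r where r: "\<And>x. x \<in> K \<Longrightarrow> norm x \<le> r"
    using compact_imp_bounded[OF K] by (auto simp: bounded_iff)
  obtain C where "C-lipschitz_on (cball 0 r) g"
    using lipg by blast
  moreover have "K \<subseteq> cball 0 r"
    using r by auto
  ultimately have "continuous_on K g"
    using lipschitz_on_continuous_on continuous_on_subset by blast
  \<comment> \<open>\<open>m\<close> is the minimum of \<open>g\<close> over \<open>K\<close>,
    positive by \<open>gpos\<close>; for empty \<open>K\<close> the value 1 serves.\<close>
  obtain m where m: "0 < m" "\<And>x. x \<in> K \<Longrightarrow> m \<le> g x"
  proof (cases "K = {}")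
    case False
    then obtain z where "z \<in> K" "\<And>x. x \<in> K \<Longrightarrow> g z \<le> g x"
      using continuous_attains_inf[OF K False \<open>continuous_on K g\<close>] by blast
    then show ?thesis
      using gpos that by blast
  qed (use that[of 1] in auto)
  txt \<open>The denominator \<open>max (g x) m\<close> keeps \<open>X\<close> Lipschitz near zeros of \<open>g\<close> and equals \<open>g x\<close> on \<open>K\<close>.\<close>
  define X where "X x = (\<chi> i. - (cutoff r x * (x $ i * (x $ i * D i x) * inverse (max (g x) m))))" for x
  have "\<exists>C. C-lipschitz_on UNIV (\<lambda>x. cutoff r x * (x $ i * (x $ i * D i x) * inverse (max (g x) m)))" for i
    by (intro lipschitz_on_cutoff_mult lipschitz_on_mult bounded_cball lipc lipxD
        lipschitz_on_inverse[OF _ m(1)] lipschitz_on_max lipg) simp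
  then have "\<exists>L. L-lipschitz_on UNIV X"
    by (intro lipschitz_on_cart) (simp add: X_def)
  moreover have f'X: "blinfun_apply (f' x) (X x) = - (cutoff r x * (g x / max (g x) m))" for x
  proof -
    define w where "w = - (cutoff r x * inverse (max (g x) m))"
    have "blinfun_apply (f' x) (X x) = (\<Sum>i\<in>UNIV. X x $ i * D i x)"
      unfolding D_def by (rule blinfun_apply_cart)
    also have "\<dots> = (\<Sum>i\<in>UNIV. w * ((x $ i * D i x) * (x $ i * D i x)))"
      by (simp add: X_def w_def mult_ac)
    also have "\<dots> = w * g x"
      by (simp add: g_def sum_distrib_left)
    finally show ?thesis
      by (simp add: w_def divide_inverse mult_ac)
  qed
  have "blinfun_apply (f' x) (X x) \<in> {-1..0}" for x
  proof -
    have "0 \<le> g x / max (g x) m" "g x / max (g x) m \<le> 1"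
      using g0[of x] m(1) by (auto simp: divide_simps)
    then have "cutoff r x * (g x / max (g x) m) \<in> {0..1}"
      unfolding atLeastAtMost_iff by (intro conjI mult_nonneg_nonneg mult_le_one cutoff_bounds)
    then show ?thesis
      by (simp add: f'X)
  qed
  moreover have "blinfun_apply (f' x) (X x) = -1" if "x \<in> K" for x
    unfolding f'X using m(1) m(2)[OF that] by (simp add: cutoff_eq_1 r that max_def)
  moreover have "X x $ i = 0" if "x $ i = 0" for x i
    using that by (simp add: X_def)
  ultimately show ?thesis
    using that by blast
qed

section \<open>Sparsity and function values along trajectories\<close>

text \<open>The short-time bound, applied to one coordinate, keeps it at zero if it starts there.
  Hence the support cannot grow.\<close>

lemma sparse_vecs_solution:
  fixes X :: "real ^ 'n::finite \<Rightarrow> real ^ 'n"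
  assumes X: "L-lipschitz_on UNIV X" and zero: "\<And>x i. x $ i = 0 \<Longrightarrow> X x $ i = 0"
    and u: "solution_on T X u" "T * L \<le> 1/2" "t \<in> {0..T}" and u0: "u 0 \<in> sparse_vecs s"
  shows "u t \<in> sparse_vecs s"
proof -
  have "u t $ i = 0" if "u 0 $ i = 0" for i
  proof -
    have "norm (u t $ i) \<le> 2 * norm (u 0 $ i)"
    proof (rule norm_le_of_derivative_le)
      fix t assume t: "t \<in> {0..T}"
      show "((\<lambda>t. u t $ i) has_vector_derivative X (u t) $ i) (at t within {0..T})"
        by (rule bounded_linear.has_vector_derivative[OF bounded_linear_vec_nth solution_onD[OF u(1) t]])
      txt \<open>\<open>X\<close> vanishes in coordinate \<open>i\<close> at the projection \<open>?z\<close>, so the Lipschitz bound makes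
        \<open>X (u t) $ i\<close> linear in \<open>u t $ i\<close>.\<close>
      let ?z = "u t - axis i (u t $ i)"
      have "X ?z $ i = 0"
        by (rule zero) (simp add: axis_def)
      then have "norm (X (u t) $ i) = norm ((X (u t) - X ?z) $ i)"
        by simp
      also have "\<dots> \<le> norm (X (u t) - X ?z)"
        by (rule Finite_Cartesian_Product.norm_nth_le)
      also have "\<dots> \<le> L * norm (u t - ?z)"
        using lipschitz_on_normD[OF X] by blast
      finally show "norm (X (u t) $ i) \<le> L * norm (u t $ i)"
        by (simp add: norm_axis_real)
    qed (use u lipschitz_on_nonneg[OF X] in auto)
    then show ?thesis
      using that by simp
  qed
  then have "{i. u t $ i \<noteq> 0} \<subseteq> {i. u 0 $ i \<noteq> 0}"
    by blast
  then have "norm0 (u t) \<le> norm0 (u 0)"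
    unfolding norm0_def by (intro card_mono) auto
  then show ?thesis
    using u0 by (simp add: sparse_vecs_def)
qed

text \<open>Mean value theorem for \<open>f\<close> along \<open>u\<close>. Arbitrary subintervals
  are allowed because both monotonicity and the total drop over \<open>{0..T}\<close> are derived
  from it.\<close>

lemma solution_on_mvt:
  fixes f :: "'a::real_normed_vector \<Rightarrow> real"
  assumes f: "\<And>x. (f has_derivative blinfun_apply (f' x)) (at x)"
    and u: "solution_on T X u" and pq: "0 \<le> p" "p \<le> q" "q \<le> T"
  obtains t where "t \<in> {p..q}" "f (u q) - f (u p) = (q - p) * blinfun_apply (f' (u t)) (X (u t))"
proof -
  have "((\<lambda>t. f (u t)) has_derivative (\<lambda>h. h * blinfun_apply (f' (u t)) (X (u t)))) (at t within {p..q})"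
    if "p \<le> t" "t \<le> q" for t
  proof -
    have "(u has_vector_derivative X (u t)) (at t within {p..q})"
      using that pq by (intro has_vector_derivative_within_subset[OF solution_onD[OF u]]) auto
    then have "((f \<circ> u) has_vector_derivative blinfun_apply (f' (u t)) (X (u t))) (at t within {p..q})"
      using has_derivative_at_withinI[OF f] by (rule vector_derivative_diff_chain_within)
    then show ?thesis
      by (simp add: has_vector_derivative_def o_def)
  qed
  from mvt_very_simple[OF pq(2) this] show ?thesis
    using that by blast
qed

theorem theorem4:
  fixes f :: "real ^ 'n::finite \<Rightarrow> real" and s :: nat and a b :: real
  assumes "s < CARD('n)"
    and "C2 f"
    and "\<And>K. compact K \<Longrightarrow> compact (f -` K \<inter> sparse_vecs s)"
    and "a < b"
    and "\<And>x. x \<in> intermediate_set f s a b \<Longrightarrow> \<not> M_stationary f s x"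
  shows "lower_level f s a homeomorphic lower_level f s b"
proof -
  obtain f' f'' where f: "\<And>x. (f has_derivative blinfun_apply (f' x)) (at x)"
    and f': "\<And>x. (f' has_derivative blinfun_apply (f'' x)) (at x)" "continuous_on UNIV f''"
    using \<open>C2 f\<close> unfolding C2_def by metis
  let ?K = "intermediate_set f s a b"
  \<comment> \<open>Properness, applied to the compact interval \<open>{a..b}\<close>, yields
    compactness of the intermediate set.\<close>
  have "?K = f -` {a..b} \<inter> sparse_vecs s"
    by (auto simp: intermediate_set_def)
  then have "compact ?K"
    using assms(3) by simp
  moreover have "\<exists>i. x $ i \<noteq> 0 \<and> blinfun_apply (f' x) (axis i 1) \<noteq> 0" if "x \<in> ?K" for x
    using assms(5)[OF that] that by (auto simp: M_stationary_def intermediate_set_def partial_deriv_eq[OF f])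
  ultimately obtain L X where X: "L-lipschitz_on UNIV X" "\<And>x i. x $ i = 0 \<Longrightarrow> X x $ i = 0"
    "\<And>x. blinfun_apply (f' x) (X x) \<in> {-1..0}" "\<And>x. x \<in> ?K \<Longrightarrow> blinfun_apply (f' x) (X x) = -1"
    using descent_field_exists[OF f f'] by blast
  have nX: "L-lipschitz_on UNIV (\<lambda>x. - X x)" "\<And>x i. x $ i = 0 \<Longrightarrow> (- X x) $ i = 0"
    using X by simp_all
  \<comment> \<open>The bounds on \<open>c\<close> put all values between \<open>c\<close> and
    \<open>c + T\<close> into \<open>{a..b}\<close>, where the descent rate is exactly 1.\<close>
  have step: "lower_level f s (c + T) homeomorphic lower_level f s c"
    if T: "0 \<le> T" "T * L \<le> 1/2" and c: "a \<le> c" "c + T \<le> b" for c T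
  proof (rule homeomorphic_by_flow[OF X(1) T])
    fix u assume u: "solution_on T X u" "u 0 \<in> lower_level f s (c + T)"
    have sparse: "u t \<in> sparse_vecs s" if "t \<in> {0..T}" for t
      using sparse_vecs_solution[OF X(1,2) u(1) T(2) that] u(2) by (simp add: lower_level_def)
    have anti: "f (u q) \<le> f (u p)" if pq: "0 \<le> p" "p \<le> q" "q \<le> T" for p q
    proof -
      obtain t where "f (u q) - f (u p) = (q - p) * blinfun_apply (f' (u t)) (X (u t))"
        using solution_on_mvt[OF f u(1) pq] by blast
      moreover have "\<dots> \<le> 0"
        using X(3)[of "u t"] pq by (intro mult_nonneg_nonpos) auto
      ultimately show ?thesis
        by linarith
    qed
    have "f (u T) \<le> c"
    proof (rule ccontr)
      txt \<open>By monotonicity a trajectory ending above \<open>c\<close> never leaves \<open>?K\<close>, so \<open>f\<close> drops at unit speed.\<close>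
      assume "\<not> f (u T) \<le> c"
      then have "u t \<in> ?K" if "t \<in> {0..T}" for t
        using that sparse[OF that] anti[of 0 t] anti[of t T] u(2) c
        by (auto simp: intermediate_set_def lower_level_def)
      moreover obtain t where "t \<in> {0..T}"
        "f (u T) - f (u 0) = (T - 0) * blinfun_apply (f' (u t)) (X (u t))"
        using solution_on_mvt[OF f u(1), of 0 T] T(1) by auto
      ultimately have "f (u T) = f (u 0) - T"
        using X(4) by simp
      then show False
        using \<open>\<not> f (u T) \<le> c\<close> u(2) by (simp add: lower_level_def)
    qed
    then show "u T \<in> lower_level f s c"
      using sparse[of T] T(1) by (simp add: lower_level_def)
  next
    fix u assume u: "solution_on T (\<lambda>x. - X x) u" "u 0 \<in> lower_level f s c"
    have "u T \<in> sparse_vecs s"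
      using sparse_vecs_solution[OF nX u(1) T(2)] u(2) T(1) by (simp add: lower_level_def)
    moreover obtain t where
      "f (u T) - f (u 0) = (T - 0) * blinfun_apply (f' (u t)) (- X (u t))"
      using solution_on_mvt[OF f u(1), of 0 T] T(1) by auto
    \<comment> \<open>Along \<open>- X\<close> the value rises at rate at most 1 everywhere, so it
      gains at most \<open>T\<close>, wherever the trajectory runs.\<close>
    moreover have "(T - 0) * blinfun_apply (f' (u t)) (- X (u t)) \<le> T * 1"
      using X(3)[of "u t"] T(1) by (intro mult_mono') (auto simp: blinfun.minus_right)
    ultimately show "u T \<in> lower_level f s (c + T)"
      using u(2) by (simp add: lower_level_def)
  qed
  \<comment> \<open>The choice makes \<open>(b - a) / N * L\<close> at most 1/2; the summand 1 keeps
    \<open>N\<close> positive even when \<open>L\<close> is 0.\<close>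
  obtain N :: nat where N: "2 * (b - a) * L + 1 \<le> real N"
    using real_arch_simple by blast
  have L0: "0 \<le> L"
    using lipschitz_on_nonneg[OF X(1)] .
  have Npos: "0 < real N"
  proof -
    have "0 \<le> 2 * (b - a) * L"
      using L0 \<open>a < b\<close> by simp
    then show ?thesis
      using N by linarith
  qed
  define T where "T = (b - a) / N"
  have T: "0 \<le> T" "T * L \<le> 1/2"
    using Npos N \<open>a < b\<close> by (auto simp: T_def field_simps)
  \<comment> \<open>Induction over the levels \<open>a + k * T\<close>, which reach \<open>b\<close>
    at \<open>k = N\<close>. The bound \<open>k \<le> N\<close> keeps each step below
    \<open>b\<close>, as \<open>step\<close> demands.\<close>
  have "lower_level f s a homeomorphic lower_level f s (a + k * T)" if "k \<le> N" for k :: nat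
    using that
  proof (induction k)
    case 0
    show ?case
      by (simp add: homeomorphic_refl)
  next
    case (Suc k)
    have "real (Suc k) * T \<le> real N * T"
      using Suc.prems T(1) by (intro mult_right_mono) auto
    also have "\<dots> = b - a"
      using Npos by (simp add: T_def)
    finally have "lower_level f s (a + k * T + T) homeomorphic lower_level f s (a + k * T)"
      using T by (intro step) (auto simp: algebra_simps)
    moreover have "a + k * T + T = a + Suc k * T"
      by (simp add: algebra_simps)
    ultimately have "lower_level f s (a + k * T) homeomorphic lower_level f s (a + Suc k * T)"
      using homeomorphic_sym by metis
    moreover have "lower_level f s a homeomorphic lower_level f s (a + k * T)"
      using Suc by simp
    ultimately show ?case
      using homeomorphic_trans by blast
  qed
  from this[of N] show ?thesis
    using Npos by (simp add: T_def)
qed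

end
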